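(* Let $E$ be a complex Banach space with open unit ball $B_E$, and let $\mathcal{A}$ denote $\mathcal{A}_u(B_E)$, $\mathcal{A}_\infty(B_E)$ or $\mathcal{H}^\infty(B_E)$. Then the dual space $\mathcal{A}^*$ does not have weak$^*$-strongly exposed points.
   Context: $B_E$ is the open unit ball and $\overline{B}_E$ the closed unit ball of $E$. $\mathcal{H}^\infty(B_E)$ is the Banach algebra of all bounded holomorphic functions $f: B_E\to\mathbb{C}$ with norm $\|f\|=\sup_{x\in B_E}|f(x)|$. $\mathcal{A}_\infty(B_E)$ is the Banach algebra of those $f\in\mathcal{H}^\infty(B_E)$ which extend continuously to $\overline{B}_E$, and $\mathcal{A}_u(B_E)$ is the closed subalgebra of those $f\in\mathcal{H}^\infty(B_E)$ which are uniformly continuous on $B_E$. A unit vector $x$ in a Banach space $X$ (with open unit ball $B_X$) is strongly exposed if there is a unit vector $x^*\in X^*$ such that $x^*(x)=1$ and every sequence $(x_n)\subseteq B_X$ with $\operatorname{Re} x^*(x_n)\to 1$ converges to $x$ in norm. If $X$ is a dual space and the functional $x^*$ which strongly exposes $x$ belongs to the predual of $X$ (viewed in $X^*$), then $x$ is called weak$^*$-strongly exposed. Here $X=\mathcal{A}^*$ is regarded as the dual of $\mathcal{A}$. *)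

theory Defs
  imports "HOL-Analysis.Analysis" "HOL-Library.Function_Algebras"
begin

section \<open>Complex Banach spaces\<close>

class scaleC =
  fixes scaleC :: "complex \<Rightarrow> 'a \<Rightarrow> 'a" (infixr "*\<^sub>C" 75)

class complex_vector = scaleC + ab_group_add +
  assumes scaleC_add_right: "a *\<^sub>C (x + y) = a *\<^sub>C x + a *\<^sub>C y"
    and scaleC_add_left: "(a + b) *\<^sub>C x = a *\<^sub>C x + b *\<^sub>C x"
    and scaleC_scaleC: "a *\<^sub>C (b *\<^sub>C x) = (a * b) *\<^sub>C x"
    and scaleC_one: "1 *\<^sub>C x = x"

class complex_normed_vector = complex_vector + real_normed_vector +
  assumes scaleR_scaleC: "r *\<^sub>R x = complex_of_real r *\<^sub>C x"
    and norm_scaleC: "norm (a *\<^sub>C x) = cmod a * norm x"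

class complex_banach = complex_normed_vector + banach

instantiation complex :: complex_banach
begin

definition scaleC_complex :: "complex \<Rightarrow> complex \<Rightarrow> complex"
  where "scaleC_complex a x = a * x"

instance
  by standard (simp_all add: scaleC_complex_def algebra_simps norm_mult scaleR_conv_of_real)

end

instantiation "fun" :: (type, complex_vector) complex_vector
begin

definition scaleC_fun :: "complex \<Rightarrow> ('a \<Rightarrow> 'b) \<Rightarrow> 'a \<Rightarrow> 'b"
  where "scaleC_fun a f = (\<lambda>x. a *\<^sub>C f x)"

instance
  by standard
    (simp_all add: scaleC_fun_def fun_eq_iff scaleC_add_right scaleC_add_left scaleC_scaleC
      scaleC_one)

end

section \<open>Dual spaces and strongly exposed points\<close>

text \<open>A normed space is given by a carrier \<open>V\<close>, a linear subspace of an ambient complex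
  vector space, together with a norm \<open>N\<close> on \<open>V\<close>.  Functionals on \<open>V\<close> are represented by
  functions on the ambient type that vanish outside \<open>V\<close>, so that equality of functionals is
  equality of functions and the dual is again a linear subspace of a function space.\<close>

definition dual_space :: "'v::complex_vector set \<Rightarrow> ('v \<Rightarrow> real) \<Rightarrow> ('v \<Rightarrow> complex) set" where
  "dual_space V N = {\<phi>.
     (\<forall>v\<in>V. \<forall>w\<in>V. \<phi> (v + w) = \<phi> v + \<phi> w) \<and>
     (\<forall>c. \<forall>v\<in>V. \<phi> (c *\<^sub>C v) = c * \<phi> v) \<and>
     (\<exists>K. \<forall>v\<in>V. cmod (\<phi> v) \<le> K * N v) \<and>
     (\<forall>v. v \<notin> V \<longrightarrow> \<phi> v = 0)}"

definition dual_norm :: "'v::complex_vector set \<Rightarrow> ('v \<Rightarrow> real) \<Rightarrow> ('v \<Rightarrow> complex) \<Rightarrow> real" where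
  "dual_norm V N \<phi> = (SUP v\<in>{v \<in> V. N v \<le> 1}. cmod (\<phi> v))"

definition canonical_embedding ::
  "'v::complex_vector set \<Rightarrow> ('v \<Rightarrow> real) \<Rightarrow> 'v \<Rightarrow> ('v \<Rightarrow> complex) \<Rightarrow> complex" where
  "canonical_embedding V N v = (\<lambda>\<phi>. if \<phi> \<in> dual_space V N then \<phi> v else 0)"

definition strongly_exposes ::
  "'v::complex_vector set \<Rightarrow> ('v \<Rightarrow> real) \<Rightarrow> ('v \<Rightarrow> complex) \<Rightarrow> 'v \<Rightarrow> bool" where
  "strongly_exposes V N \<phi> x \<longleftrightarrow>
     x \<in> V \<and> N x = 1 \<and>
     \<phi> \<in> dual_space V N \<and> dual_norm V N \<phi> = 1 \<and>
     \<phi> x = 1 \<and>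
     (\<forall>s :: nat \<Rightarrow> 'v.
        (\<forall>n. s n \<in> V \<and> N (s n) < 1) \<and> (\<lambda>n. Re (\<phi> (s n))) \<longlonglongrightarrow> 1 \<longrightarrow>
        (\<lambda>n. N (s n - x)) \<longlonglongrightarrow> 0)"

text \<open>Here \<open>\<phi>\<close> is a point of the dual of \<open>V\<close>, and the exposing functional is required to lie in
  the image of the predual \<open>V\<close> in its bidual.\<close>

definition weak_star_strongly_exposed_point ::
  "'v::complex_vector set \<Rightarrow> ('v \<Rightarrow> real) \<Rightarrow> ('v \<Rightarrow> complex) \<Rightarrow> bool" where
  "weak_star_strongly_exposed_point V N \<phi> \<longleftrightarrow>
     (\<exists>v\<in>V. strongly_exposes (dual_space V N) (dual_norm V N) (canonical_embedding V N v) \<phi>)"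

section \<open>Algebras of bounded holomorphic functions on the unit ball\<close>

text \<open>Holomorphy is complex Frechet differentiability: the derivative, which is bounded and
  real-linear by \<^const>\<open>has_derivative\<close>, must commute with complex scalars.\<close>

definition holomorphic_banach ::
  "('e::complex_normed_vector \<Rightarrow> complex) \<Rightarrow> 'e set \<Rightarrow> bool" where
  "holomorphic_banach f U \<longleftrightarrow>
     (\<forall>x\<in>U. \<exists>D. (f has_derivative D) (at x within U) \<and> (\<forall>c v. D (c *\<^sub>C v) = c * D v))"

text \<open>Functions on the open unit ball are represented by functions on the whole space that
  vanish outside the ball.\<close>

definition Hinf_ball :: "('e::complex_banach \<Rightarrow> complex) set" where
  "Hinf_ball = {f. holomorphic_banach f (ball 0 1) \<and> bounded (f ` ball 0 1) \<and>
                   (\<forall>x. x \<notin> ball 0 1 \<longrightarrow> f x = 0)}"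

definition Ainf_ball :: "('e::complex_banach \<Rightarrow> complex) set" where
  "Ainf_ball = {f \<in> Hinf_ball. \<exists>g. continuous_on (cball 0 1) g \<and> (\<forall>x\<in>ball 0 1. g x = f x)}"

definition Au_ball :: "('e::complex_banach \<Rightarrow> complex) set" where
  "Au_ball = {f \<in> Hinf_ball. uniformly_continuous_on (ball 0 1) f}"

definition sup_norm_ball :: "('e::complex_banach \<Rightarrow> complex) \<Rightarrow> real" where
  "sup_norm_ball f = (SUP x\<in>ball 0 1. cmod (f x))"

end

theory Submission
  imports Defs "HOL-Complex_Analysis.Conformal_Mappings"
begin

text \<open>Let \<open>f\<close> in the algebra \<open>A\<close> expose the point \<open>\<phi>\<close> of the dual.  Then \<open>f\<close> has norm \<open>1\<close>, and whenever
  \<open>\<bar>f (x n)\<bar>\<close> tends to \<open>1\<close>, suitably rotated and slightly shrunk evaluations at the points \<open>x n\<close> have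
  values at \<open>f\<close> tending to \<open>1\<close>; so they converge to \<open>\<phi>\<close> in norm
  (\<open>evaluations_converge_to_exposed_point\<close>).  Two cases are ruled out.

  If \<open>\<bar>f\<bar> < 1\<close> on the whole ball, the powers of \<open>f\<close> give a contradiction: \<open>\<bar>\<phi> (f ^ k)\<bar> = 1\<close> for all
  positive \<open>k\<close>, while \<open>f ^ k\<close> tends to \<open>0\<close> at each single point, so no evaluation can be close to
  \<open>\<phi>\<close> uniformly on the unit ball of \<open>A\<close> (\<open>exposing_function_attains_norm\<close>).

  If \<open>\<bar>f\<bar> = 1\<close> somewhere, the maximum principle on complex lines makes \<open>f\<close> constant
  (\<open>maximum_modulus_convex\<close>).  Then all evaluations, up to rotation, are equal to \<open>\<phi>\<close>, so every
  element of \<open>A\<close> has constant modulus (\<open>no_weak_star_strongly_exposed_point\<close>).  But a nonzero space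
  carries a nonzero bounded complex-linear functional, by the Hahn--Banach theorem
  (\<open>complex_norming_functional\<close>), and its restriction to the ball belongs to \<open>A\<close>.\<close>

section \<open>The Hahn--Banach theorem for the norm\<close>

definition norm_dominated_sublinear :: "('a::real_normed_vector \<Rightarrow> real) \<Rightarrow> bool" where
  "norm_dominated_sublinear p \<longleftrightarrow>
     (\<forall>x y. p (x + y) \<le> p x + p y) \<and> (\<forall>t>0. \<forall>x. p (t *\<^sub>R x) \<le> t * p x) \<and> (\<forall>x. p x \<le> norm x)"

lemma norm_dominated_sublinear_props:
  assumes "norm_dominated_sublinear p"
  shows norm_dominated_add: "p (x + y) \<le> p x + p y"
    and norm_dominated_scaleR: "t \<ge> 0 \<Longrightarrow> p (t *\<^sub>R x) = t * p x"
    and norm_dominated_zero: "p 0 = 0"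
    and norm_dominated_upper: "p x \<le> norm x"
    and norm_dominated_lower: "- norm x \<le> p x"
proof -
  have add: "\<And>x y. p (x + y) \<le> p x + p y" and up: "\<And>x. p x \<le> norm x"
    and scale: "\<And>t x. t > 0 \<Longrightarrow> p (t *\<^sub>R x) \<le> t * p x"
    using assms by (auto simp: norm_dominated_sublinear_def)
  show "p (x + y) \<le> p x + p y" "p x \<le> norm x" by (rule add, rule up)
  show zero: "p 0 = 0" using add[of 0 0] up[of 0] by simp
  show "- norm x \<le> p x" using add[of x "- x"] up[of "- x"] zero by simp
  show "p (t *\<^sub>R x) = t * p x" if "t \<ge> 0"
  proof (cases "t = 0")
    case False
    with that have "t > 0" by simp
    moreover have "p x \<le> (1 / t) * p (t *\<^sub>R x)"
      using scale[of "1 / t" "t *\<^sub>R x"] \<open>t > 0\<close> by simp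
    ultimately show ?thesis using scale[of t x] by (simp add: field_simps)
  qed (simp add: zero)
qed

text \<open>Among the sublinear functionals below \<open>p\<close> that grow with exact slope \<open>p x\<close> along the direction
  \<open>x\<close>, forwards and backwards, this is the largest.\<close>
definition directional_inf ::
  "('a::real_normed_vector \<Rightarrow> real) \<Rightarrow> 'a \<Rightarrow> 'a \<Rightarrow> real" where
  "directional_inf p x y = (INF t\<in>{0..}. p (y + t *\<^sub>R x) - t * p x)"

lemma directional_inf_le:
  assumes p: "norm_dominated_sublinear p" and "t \<ge> 0"
  shows "directional_inf p x y \<le> p (y + t *\<^sub>R x) - t * p x"
  unfolding directional_inf_def
proof (rule cINF_lower)
  have "- norm y \<le> p (y + t *\<^sub>R x) - t * p x" if "t \<ge> 0" for t
  proof -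
    have "t * p x = p ((y + t *\<^sub>R x) + (- y))"
      using norm_dominated_scaleR[OF p that, of x] by simp
    also have "\<dots> \<le> p (y + t *\<^sub>R x) + p (- y)" by (rule norm_dominated_add[OF p])
    finally show ?thesis using norm_dominated_upper[OF p, of "- y"] by simp
  qed
  then show "bdd_below ((\<lambda>t. p (y + t *\<^sub>R x) - t * p x) ` {0..})"
    by (auto intro!: bdd_belowI2[where m = "- norm y"])
qed (use \<open>t \<ge> 0\<close> in simp)

lemma norm_dominated_directional_inf:
  assumes p: "norm_dominated_sublinear p"
  shows "norm_dominated_sublinear (directional_inf p x)"
    and "directional_inf p x \<le> p"
    and "directional_inf p x (- x) \<le> - p x"
proof -
  let ?q = "directional_inf p x"
  have greatest: "m \<le> ?q y" if "\<And>t. t \<ge> 0 \<Longrightarrow> m \<le> p (y + t *\<^sub>R x) - t * p x" for m y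
    unfolding directional_inf_def using that by (intro cINF_greatest) auto
  have le: "?q y \<le> p y" for y
    using directional_inf_le[OF p, of 0 x y] by simp
  then show "?q \<le> p" by (simp add: le_fun_def)
  show "?q (- x) \<le> - p x"
    using directional_inf_le[OF p, of 1 x "- x"] norm_dominated_zero[OF p] by simp
  have "?q (y + z) \<le> ?q y + ?q z" for y z
  proof -
    have "?q (y + z) - (p (z + t *\<^sub>R x) - t * p x) \<le> p (y + s *\<^sub>R x) - s * p x"
      if "s \<ge> 0" "t \<ge> 0" for s t
    proof -
      have "?q (y + z) \<le> p ((y + s *\<^sub>R x) + (z + t *\<^sub>R x)) - (s + t) * p x"
        using directional_inf_le[OF p, of "s + t" x "y + z"] that
        by (simp add: algebra_simps)
      also have "\<dots> \<le> p (y + s *\<^sub>R x) + p (z + t *\<^sub>R x) - (s + t) * p x"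
        using norm_dominated_add[OF p] by simp
      finally show ?thesis by (simp add: algebra_simps)
    qed
    then have "?q (y + z) - (p (z + t *\<^sub>R x) - t * p x) \<le> ?q y" if "t \<ge> 0" for t
      using that by (intro greatest) auto
    then have "?q (y + z) - ?q y \<le> ?q z"
      by (intro greatest) (auto simp: algebra_simps)
    then show ?thesis by simp
  qed
  moreover have "?q (c *\<^sub>R y) \<le> c * ?q y" if "c > 0" for c y
  proof -
    have "?q (c *\<^sub>R y) / c \<le> ?q y"
    proof (rule greatest)
      fix t :: real assume "t \<ge> 0"
      have "?q (c *\<^sub>R y) \<le> p (c *\<^sub>R (y + t *\<^sub>R x)) - (c * t) * p x"
        using directional_inf_le[OF p, of "c * t" x "c *\<^sub>R y"] that \<open>t \<ge> 0\<close>
        by (simp add: algebra_simps)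
      also have "\<dots> = c * (p (y + t *\<^sub>R x) - t * p x)"
        using norm_dominated_scaleR[OF p, of c "y + t *\<^sub>R x"] that
        by (simp add: right_diff_distrib)
      also have "\<dots> = (p (y + t *\<^sub>R x) - t * p x) * c" by (rule mult.commute)
      finally show "?q (c *\<^sub>R y) / c \<le> p (y + t *\<^sub>R x) - t * p x"
        using that by (simp add: pos_divide_le_eq)
    qed
    then show ?thesis using that by (simp add: field_simps)
  qed
  moreover have "?q y \<le> norm y" for y
    using le[of y] norm_dominated_upper[OF p, of y] by simp
  ultimately show "norm_dominated_sublinear ?q" by (auto simp: norm_dominated_sublinear_def)
qed

text \<open>Pointwise infima of nonempty chains stay sublinear, because for any two members of a chain the
  smaller one serves both in the triangle inequality.  This is the hypothesis of Zorn's lemma.\<close>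
lemma norm_dominated_chain_Inf:
  assumes "C \<noteq> {}" and C: "\<And>p. p \<in> C \<Longrightarrow> norm_dominated_sublinear p"
    and chain: "\<And>p q. p \<in> C \<Longrightarrow> q \<in> C \<Longrightarrow> p \<le> q \<or> q \<le> p"
  shows "norm_dominated_sublinear (\<lambda>x. INF p\<in>C. p x)"
    and "p \<in> C \<Longrightarrow> (\<lambda>x. INF p\<in>C. p x) \<le> p"
proof -
  let ?u = "\<lambda>x. INF p\<in>C. p x"
  have lower: "?u x \<le> p x" if "p \<in> C" for p x
    using that norm_dominated_lower[OF C]
    by (intro cINF_lower) (auto intro!: bdd_belowI2[where m = "- norm x"])
  show "?u \<le> p" if "p \<in> C"
    using lower[OF that] by (simp add: le_fun_def)
  have greatest: "m \<le> ?u x" if "\<And>p. p \<in> C \<Longrightarrow> m \<le> p x" for m x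
    using that \<open>C \<noteq> {}\<close> by (intro cINF_greatest) auto
  have "?u (x + y) \<le> ?u x + ?u y" for x y
  proof -
    have "?u (x + y) - q y \<le> p x" if pq: "p \<in> C" "q \<in> C" for p q
    proof -
      obtain r where r: "r \<in> C" "r \<le> p" "r \<le> q" using chain[OF pq] pq by blast
      have "?u (x + y) \<le> r x + r y"
        using lower[OF r(1), of "x + y"] norm_dominated_add[OF C[OF r(1)], of x y] by simp
      also have "\<dots> \<le> p x + q y" using r by (simp add: add_mono le_fun_def)
      finally show ?thesis by simp
    qed
    then have "?u (x + y) - q y \<le> ?u x" if "q \<in> C" for q
      using that by (intro greatest)
    then have "?u (x + y) - ?u x \<le> ?u y"
      by (intro greatest) (simp add: algebra_simps)
    then show ?thesis by simp
  qed
  moreover have "?u (t *\<^sub>R x) \<le> t * ?u x" if "t > 0" for t x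
  proof -
    have "?u (t *\<^sub>R x) / t \<le> ?u x"
    proof (rule greatest)
      fix p assume "p \<in> C"
      then show "?u (t *\<^sub>R x) / t \<le> p x"
        using lower[of p "t *\<^sub>R x"] norm_dominated_scaleR[OF C, of p t x] that
        by (simp add: pos_divide_le_eq mult.commute)
    qed
    then show ?thesis using that by (simp add: field_simps)
  qed
  moreover have "?u x \<le> norm x" for x
  proof -
    obtain p where "p \<in> C" using \<open>C \<noteq> {}\<close> by blast
    then show ?thesis using lower[of p x] norm_dominated_upper[OF C, of p x] by simp
  qed
  ultimately show "norm_dominated_sublinear ?u" by (auto simp: norm_dominated_sublinear_def)
qed

text \<open>A minimal sublinear functional \<open>u\<close> equals each of its own directional infima, hence
  \<open>u (- x) \<le> - u x\<close> for every \<open>x\<close>; an odd sublinear functional is linear.  Starting Zorn's lemma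
  below the directional infimum of the norm in the direction \<open>x0\<close>, rather than below the norm,
  forces \<open>u (- x0) \<le> - norm x0\<close> and so fixes the value at \<open>x0\<close>.\<close>
lemma real_norming_functional:
  fixes x0 :: "'a::real_normed_vector"
  obtains u where "linear u" "\<And>x. \<bar>u x\<bar> \<le> norm x" "u x0 = norm x0"
proof -
  define p0 where "p0 = directional_inf norm x0"
  have norm_sub: "norm_dominated_sublinear (norm :: 'a \<Rightarrow> real)"
    by (simp add: norm_dominated_sublinear_def norm_triangle_ineq)
  have p0: "norm_dominated_sublinear p0" "p0 (- x0) \<le> - norm x0"
    unfolding p0_def by (rule norm_dominated_directional_inf[OF norm_sub])+
  define S where "S = {p. norm_dominated_sublinear p \<and> p \<le> p0}"
  have "\<exists>u\<in>S. \<forall>a\<in>S. a \<le> u \<longrightarrow> a = u"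
  proof (rule predicate_Zorn)
    show "partial_order_on S (relation_of (\<lambda>p q. q \<le> p) S)"
      by (rule partial_order_on_relation_ofI) auto
    fix C assume "C \<in> Chains (relation_of (\<lambda>p q. q \<le> p) S)"
    then have CS: "C \<subseteq> S" and chain: "\<And>p q. p \<in> C \<Longrightarrow> q \<in> C \<Longrightarrow> p \<le> q \<or> q \<le> p"
      by (auto simp: Chains_def relation_of_def)
    show "\<exists>u\<in>S. \<forall>a\<in>C. u \<le> a"
    proof (cases "C = {}")
      case True
      then show ?thesis using p0 by (auto simp: S_def)
    next
      case False
      then obtain p where "p \<in> C" by blast
      have C: "\<And>p. p \<in> C \<Longrightarrow> norm_dominated_sublinear p" using CS by (auto simp: S_def)
      note inf = norm_dominated_chain_Inf[OF False C chain]
      have "p \<le> p0" using \<open>p \<in> C\<close> CS by (auto simp: S_def)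
      with inf(2)[OF _ _ _ \<open>p \<in> C\<close>] have "(\<lambda>x. INF p\<in>C. p x) \<le> p0" by force
      then have "(\<lambda>x. INF p\<in>C. p x) \<in> S" using inf(1) by (auto simp: S_def)
      then show ?thesis using inf(2) by blast
    qed
  qed
  then obtain u where u: "norm_dominated_sublinear u" "u \<le> p0"
    and minimal: "\<And>q. norm_dominated_sublinear q \<Longrightarrow> q \<le> u \<Longrightarrow> q = u"
    by (auto simp: S_def intro: order_trans)
  have odd: "u (- x) = - u x" for x
  proof -
    have "directional_inf u x = u"
      by (intro minimal norm_dominated_directional_inf u)
    then have "u (- x) \<le> - u x"
      using norm_dominated_directional_inf(3)[OF u(1), of x] by simp
    moreover have "0 \<le> u x + u (- x)"
      using norm_dominated_add[OF u(1), of x "- x"] norm_dominated_zero[OF u(1)] by simp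
    ultimately show ?thesis by simp
  qed
  have "linear u"
  proof (rule linearI)
    show "u (x + y) = u x + u y" for x y
      using norm_dominated_add[OF u(1), of x y] norm_dominated_add[OF u(1), of "- x" "- y"]
        odd[of x] odd[of y] odd[of "x + y"] by simp
    show "u (t *\<^sub>R x) = t *\<^sub>R u x" for t x
    proof (cases "t \<ge> 0")
      case False
      then show ?thesis
        using norm_dominated_scaleR[OF u(1), of "- t" x] odd[of "t *\<^sub>R x"] by simp
    qed (simp add: norm_dominated_scaleR[OF u(1)])
  qed
  moreover have "\<bar>u x\<bar> \<le> norm x" for x
    using norm_dominated_upper[OF u(1), of x] norm_dominated_lower[OF u(1), of x] by simp
  moreover have "u x0 = norm x0"
  proof -
    have "u (- x0) \<le> - norm x0" using u(2) p0(2) by (meson le_funD order_trans)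
    with odd[of x0] norm_dominated_upper[OF u(1), of x0] show ?thesis by simp
  qed
  ultimately show thesis by (rule that)
qed

lemma scaleC_zero_left: "0 *\<^sub>C (x::'a::complex_vector) = 0"
  using scaleC_add_left[of 0 0 x] by simp

lemma unimodular_rotation:
  obtains u where "cmod u = 1" "u * z = of_real (cmod z)"
proof (cases "z = 0")
  case True
  then show thesis using that[of 1] by simp
next
  case False
  then show thesis using that[of "of_real (cmod z) / z"] by (simp add: norm_divide)
qed

text \<open>The usual complexification \<open>L x = u x - \<i> u (\<i> x)\<close> of a real norming functional \<open>u\<close>.\<close>
lemma complex_norming_functional:
  fixes x0 :: "'e::complex_normed_vector"
  obtains L :: "'e \<Rightarrow> complex" where "bounded_linear L" "\<And>c x. L (c *\<^sub>C x) = c * L x"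
    "\<And>x. cmod (L x) \<le> norm x" "Re (L x0) = norm x0"
proof -
  obtain u :: "'e \<Rightarrow> real" where u: "linear u" "\<And>x. \<bar>u x\<bar> \<le> norm x" "u x0 = norm x0"
    using real_norming_functional[of x0] by blast
  define L where "L x = Complex (u x) (- u (\<i> *\<^sub>C x))" for x
  have uC: "u (c *\<^sub>C x) = Re c * u x + Im c * u (\<i> *\<^sub>C x)" for c x
  proof -
    have "Re c *\<^sub>R x + Im c *\<^sub>R (\<i> *\<^sub>C x)
        = (complex_of_real (Re c) + complex_of_real (Im c) * \<i>) *\<^sub>C x"
      by (simp only: scaleR_scaleC[where ?'a = 'e] scaleC_scaleC scaleC_add_left)
    also have "complex_of_real (Re c) + complex_of_real (Im c) * \<i> = c"
      by (simp add: complex_eq_iff)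
    finally have "c *\<^sub>C x = Re c *\<^sub>R x + Im c *\<^sub>R (\<i> *\<^sub>C x)" ..
    then show ?thesis by (simp add: linear_add[OF u(1)] linear_scale[OF u(1)])
  qed
  have LC: "L (c *\<^sub>C x) = c * L x" for c x
  proof -
    have "\<i> *\<^sub>C (c *\<^sub>C x) = (\<i> * c) *\<^sub>C x" by (simp add: scaleC_scaleC)
    then show ?thesis unfolding L_def by (simp add: uC[of c] uC[of "\<i> * c"] complex_eq_iff)
  qed
  have bound: "cmod (L x) \<le> norm x" for x
  proof -
    \<comment> \<open>Rotating \<open>x\<close> makes \<open>L x\<close> real, where it agrees with \<open>u\<close>.\<close>
    obtain c where c: "cmod c = 1" "c * L x = of_real (cmod (L x))"
      using unimodular_rotation[of "L x"] by blast
    have "cmod (L x) = Re (L (c *\<^sub>C x))" by (simp only: LC c(2) Re_complex_of_real)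
    also have "\<dots> = u (c *\<^sub>C x)" by (simp add: L_def)
    also have "\<dots> \<le> norm (c *\<^sub>C x)" using u(2)[of "c *\<^sub>C x"] by simp
    also have "\<dots> = norm x" by (simp add: norm_scaleC c(1))
    finally show ?thesis .
  qed
  have "bounded_linear L"
  proof (rule bounded_linear_intro[where K = 1])
    show "L (x + y) = L x + L y" for x y
      by (simp add: L_def linear_add[OF u(1)] scaleC_add_right complex_eq_iff)
    show "L (r *\<^sub>R x) = r *\<^sub>R L x" for r x
      by (simp only: scaleR_scaleC[where ?'a = 'e] LC scaleR_conv_of_real)
  qed (simp add: bound)
  then show thesis using LC bound u(3) by (intro that[of L]) (simp_all add: L_def)
qed

section \<open>The maximum principle on convex open sets\<close>

lemma holomorphic_along_complex_line:
  fixes f :: "'e::complex_normed_vector \<Rightarrow> complex"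
  assumes "holomorphic_banach f U" "open U"
  shows "(\<lambda>t. f (x + t *\<^sub>C v)) holomorphic_on {t. x + t *\<^sub>C v \<in> U}"
    and "open {t. x + t *\<^sub>C v \<in> U}"
proof -
  have lin: "bounded_linear (\<lambda>t. t *\<^sub>C v)"
  proof (rule bounded_linear_intro[where K = "norm v"])
    show "(r *\<^sub>R t) *\<^sub>C v = r *\<^sub>R (t *\<^sub>C v)" for r t
      by (simp only: scaleR_scaleC[where ?'a = 'e] scaleC_scaleC scaleR_conv_of_real)
  qed (simp_all only: scaleC_add_left norm_scaleC order_refl)
  have cont: "continuous_on UNIV (\<lambda>t. x + t *\<^sub>C v)"
    by (intro continuous_intros linear_continuous_on lin)
  show op: "open {t. x + t *\<^sub>C v \<in> U}"
    using open_vimage[OF \<open>open U\<close> cont] by (simp add: vimage_def)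
  show "(\<lambda>t. f (x + t *\<^sub>C v)) holomorphic_on {t. x + t *\<^sub>C v \<in> U}"
  proof (rule holomorphic_onI)
    fix t assume "t \<in> {t. x + t *\<^sub>C v \<in> U}"
    then obtain D where D: "(f has_derivative D) (at (x + t *\<^sub>C v))" "\<And>c w. D (c *\<^sub>C w) = c * D w"
      using assms at_within_open[OF _ \<open>open U\<close>] unfolding holomorphic_banach_def
      by (metis mem_Collect_eq)
    have "((\<lambda>t. x + t *\<^sub>C v) has_derivative (\<lambda>s. s *\<^sub>C v)) (at t)"
      using has_derivative_add[OF has_derivative_const bounded_linear_imp_has_derivative[OF lin]]
      by simp
    from has_derivative_compose[OF this D(1)]
    have "((\<lambda>t. f (x + t *\<^sub>C v)) has_field_derivative D v) (at t)"
      by (rule has_derivative_imp_has_field_derivative) (simp add: D(2))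
    then show "(\<lambda>t. f (x + t *\<^sub>C v)) field_differentiable at t within {t. x + t *\<^sub>C v \<in> U}"
      using field_differentiable_at_within field_differentiable_def by blast
  qed
qed

text \<open>The complex line through \<open>x\<close> and \<open>y\<close> meets \<open>U\<close> in a convex, hence connected, open set of
  parameters, so the maximum principle in one variable applies along it.\<close>
lemma maximum_modulus_convex:
  fixes f :: "'e::complex_normed_vector \<Rightarrow> complex"
  assumes f: "holomorphic_banach f U" "open U" "convex U"
    and "x \<in> U" and max: "\<And>y. y \<in> U \<Longrightarrow> cmod (f y) \<le> cmod (f x)" and "y \<in> U"
  shows "f y = f x"
proof -
  define T where "T = {t. x + t *\<^sub>C (y - x) \<in> U}"
  define h where "h t = f (x + t *\<^sub>C (y - x))" for t
  have "convex T"
  proof (rule convexI)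
    fix s t :: complex and a b :: real
    assume st: "s \<in> T" "t \<in> T" and ab: "0 \<le> a" "0 \<le> b" "a + b = 1"
    have "r *\<^sub>R (z *\<^sub>C w) = (r *\<^sub>R z) *\<^sub>C w" for r z and w :: 'e
      by (simp only: scaleR_scaleC[where ?'a = 'e] scaleC_scaleC scaleR_conv_of_real)
    then have "a *\<^sub>R (x + s *\<^sub>C (y - x)) + b *\<^sub>R (x + t *\<^sub>C (y - x))
        = (a + b) *\<^sub>R x + (a *\<^sub>R s + b *\<^sub>R t) *\<^sub>C (y - x)"
      by (simp only: scaleR_add_right scaleR_add_left scaleC_add_left ac_simps)
    moreover have "a *\<^sub>R (x + s *\<^sub>C (y - x)) + b *\<^sub>R (x + t *\<^sub>C (y - x)) \<in> U"
      using st ab by (intro convexD[OF \<open>convex U\<close>]) (simp_all add: T_def)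
    ultimately show "a *\<^sub>R s + b *\<^sub>R t \<in> T" using ab by (simp only: T_def scaleR_one mem_Collect_eq)
  qed
  have zero: "h 0 = f x" "0 \<in> T" and one: "h 1 = f y" "1 \<in> T"
    using \<open>x \<in> U\<close> \<open>y \<in> U\<close> by (simp_all add: h_def T_def scaleC_zero_left scaleC_one)
  have "h constant_on T"
  proof (rule maximum_modulus_principle)
    show "h holomorphic_on T" "open T" "open T"
      using holomorphic_along_complex_line[OF f(1,2), of x "y - x"]
      by (simp_all add: h_def[abs_def] T_def)
    show "connected T" using \<open>convex T\<close> by (rule convex_connected)
    show "cmod (h t) \<le> cmod (h 0)" if "t \<in> T" for t
      using that max[of "x + t *\<^sub>C (y - x)"] zero by (simp add: h_def T_def)
  qed (use zero in auto)
  then show ?thesis using zero one by (metis constant_on_def)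
qed

section \<open>The three algebras\<close>

lemma bdd_above_cmod_ball:
  assumes "bounded (f ` ball 0 1)"
  shows "bdd_above ((\<lambda>x. cmod (f x)) ` ball 0 1)"
proof -
  obtain K where "\<And>x. x \<in> ball 0 1 \<Longrightarrow> cmod (f x) \<le> K"
    using assms unfolding bounded_iff by blast
  then show ?thesis by (rule bdd_aboveI2)
qed

lemma sup_norm_ball_le_one_iff:
  assumes "bounded (f ` ball 0 1)"
  shows "sup_norm_ball f \<le> 1 \<longleftrightarrow> (\<forall>x\<in>ball 0 1. cmod (f x) \<le> 1)"
  unfolding sup_norm_ball_def using bdd_above_cmod_ball[OF assms] by (subst cSUP_le_iff) auto

text \<open>Products enter the argument only as powers of a single function.  The exponents are positive
  because elements vanish outside the ball, which the power with exponent \<open>0\<close> does not.\<close>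
locale ball_algebra =
  fixes A :: "('e::complex_banach \<Rightarrow> complex) set"
  assumes bounded: "f \<in> A \<Longrightarrow> bounded (f ` ball 0 1)"
    and zero_closed: "0 \<in> A"
    and add_closed: "f \<in> A \<Longrightarrow> g \<in> A \<Longrightarrow> f + g \<in> A"
    and scaleC_closed: "f \<in> A \<Longrightarrow> c *\<^sub>C f \<in> A"
    and power_closed: "f \<in> A \<Longrightarrow> (\<lambda>x. f x ^ Suc k) \<in> A"

lemma ball_algebra_Hinf: "ball_algebra Hinf_ball"
proof
  fix f g :: "'e::complex_banach \<Rightarrow> complex" and c k
  show "(0 :: 'e \<Rightarrow> complex) \<in> Hinf_ball"
    by (auto simp: Hinf_ball_def holomorphic_banach_def bounded_iff zero_fun_def
        intro!: exI[of _ "\<lambda>x. 0"])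
  assume "f \<in> Hinf_ball"
  then have f: "bounded (f ` ball 0 1)" "\<And>x. x \<notin> ball 0 1 \<Longrightarrow> f x = 0"
    and hol_f: "\<And>x. x \<in> ball 0 1 \<Longrightarrow>
      \<exists>D. (f has_derivative D) (at x within ball 0 1) \<and> (\<forall>c v. D (c *\<^sub>C v) = c * D v)"
    by (auto simp: Hinf_ball_def holomorphic_banach_def)
  show "bounded (f ` ball 0 1)" by (rule f)
  obtain K where K: "\<And>x. x \<in> ball 0 1 \<Longrightarrow> cmod (f x) \<le> K" using f(1) unfolding bounded_iff by blast
  {
    assume "g \<in> Hinf_ball"
    then have g: "bounded (g ` ball 0 1)" "\<And>x. x \<notin> ball 0 1 \<Longrightarrow> g x = 0"
      and hol_g: "\<And>x. x \<in> ball 0 1 \<Longrightarrow>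
        \<exists>D. (g has_derivative D) (at x within ball 0 1) \<and> (\<forall>c v. D (c *\<^sub>C v) = c * D v)"
      by (auto simp: Hinf_ball_def holomorphic_banach_def)
    have "holomorphic_banach (f + g) (ball 0 1)"
      unfolding holomorphic_banach_def
    proof
      fix x :: 'e assume "x \<in> ball 0 1"
      then obtain D E where
        "(f has_derivative D) (at x within ball 0 1)" "\<And>c v. D (c *\<^sub>C v) = c * D v"
        "(g has_derivative E) (at x within ball 0 1)" "\<And>c v. E (c *\<^sub>C v) = c * E v"
        using hol_f hol_g by meson
      then show "\<exists>D. (f + g has_derivative D) (at x within ball 0 1) \<and> (\<forall>c v. D (c *\<^sub>C v) = c * D v)"
        by (intro exI[of _ "\<lambda>v. D v + E v"])
          (auto simp: plus_fun_def algebra_simps intro: has_derivative_add)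
    qed
    moreover have "bounded ((f + g) ` ball 0 1)"
      using bounded_plus_comp[OF f(1) g(1)] by (simp add: plus_fun_def)
    ultimately show "f + g \<in> Hinf_ball"
      using f(2) g(2) by (simp add: Hinf_ball_def)
  }
  have "holomorphic_banach (c *\<^sub>C f) (ball 0 1)"
    unfolding holomorphic_banach_def
  proof
    fix x :: 'e assume "x \<in> ball 0 1"
    then obtain D where
      D: "(f has_derivative D) (at x within ball 0 1)" "\<And>c v. D (c *\<^sub>C v) = c * D v"
      using hol_f by meson
    then show "\<exists>D. (c *\<^sub>C f has_derivative D) (at x within ball 0 1) \<and> (\<forall>c v. D (c *\<^sub>C v) = c * D v)"
      using has_derivative_mult_right[OF D(1), of c]
      by (intro exI[of _ "\<lambda>v. c * D v"]) (auto simp: scaleC_fun_def scaleC_complex_def)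
  qed
  moreover have "cmod ((c *\<^sub>C f) x) \<le> cmod c * K" if "x \<in> ball 0 1" for x
    using K[OF that] by (simp add: scaleC_fun_def scaleC_complex_def norm_mult mult_left_mono)
  then have "bounded ((c *\<^sub>C f) ` ball 0 1)"
    by (intro boundedI[where B = "cmod c * K"]) auto
  ultimately show "c *\<^sub>C f \<in> Hinf_ball"
    using f(2) by (simp add: Hinf_ball_def scaleC_fun_def scaleC_complex_def)
  have "holomorphic_banach (\<lambda>x. f x ^ Suc k) (ball 0 1)"
    unfolding holomorphic_banach_def
  proof
    fix x :: 'e assume "x \<in> ball 0 1"
    then obtain D where
      D: "(f has_derivative D) (at x within ball 0 1)" "\<And>c v. D (c *\<^sub>C v) = c * D v"
      using hol_f by meson
    show "\<exists>D. ((\<lambda>x. f x ^ Suc k) has_derivative D) (at x within ball 0 1) \<and> (\<forall>c v. D (c *\<^sub>C v) = c * D v)"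
      using has_derivative_power[OF D(1), of "Suc k"] D(2)
      by (intro exI conjI) (assumption, simp add: algebra_simps)
  qed
  moreover have "cmod (f x ^ Suc k) \<le> K ^ Suc k" if "x \<in> ball 0 1" for x
    unfolding norm_power using K[OF that] by (intro power_mono) auto
  then have "bounded ((\<lambda>x. f x ^ Suc k) ` ball 0 1)"
    by (intro boundedI[where B = "K ^ Suc k"]) (auto simp del: power_Suc)
  ultimately show "(\<lambda>x. f x ^ Suc k) \<in> Hinf_ball"
    using f(2) by (simp add: Hinf_ball_def)
qed

lemma ball_algebra_Ainf: "ball_algebra Ainf_ball"
proof
  interpret H: ball_algebra Hinf_ball by (rule ball_algebra_Hinf)
  fix f g :: "'e::complex_banach \<Rightarrow> complex" and c k
  show "(0 :: 'e \<Rightarrow> complex) \<in> Ainf_ball"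
    using H.zero_closed by (auto simp: Ainf_ball_def intro!: exI[of _ "\<lambda>x. 0"])
  assume "f \<in> Ainf_ball"
  then obtain f' where f: "f \<in> Hinf_ball" "continuous_on (cball 0 1) f'"
    "\<And>x. x \<in> ball 0 1 \<Longrightarrow> f' x = f x"
    by (auto simp: Ainf_ball_def)
  show "bounded (f ` ball 0 1)" using f(1) by (rule H.bounded)
  show "c *\<^sub>C f \<in> Ainf_ball"
    using f H.scaleC_closed[OF f(1)]
    by (auto simp: Ainf_ball_def scaleC_fun_def scaleC_complex_def
        intro!: exI[of _ "\<lambda>x. c * f' x"] continuous_intros)
  show "(\<lambda>x. f x ^ Suc k) \<in> Ainf_ball"
    using f H.power_closed[OF f(1)]
    by (auto simp: Ainf_ball_def intro!: exI[of _ "\<lambda>x. f' x ^ Suc k"] continuous_intros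
        simp del: power_Suc)
  assume "g \<in> Ainf_ball"
  then obtain g' where g: "g \<in> Hinf_ball" "continuous_on (cball 0 1) g'"
    "\<And>x. x \<in> ball 0 1 \<Longrightarrow> g' x = g x"
    by (auto simp: Ainf_ball_def)
  show "f + g \<in> Ainf_ball"
    using f g H.add_closed[OF f(1) g(1)]
    by (auto simp: Ainf_ball_def intro!: exI[of _ "\<lambda>x. f' x + g' x"] continuous_intros)
qed

lemma uniformly_continuous_on_power_bounded:
  fixes f :: "'a::metric_space \<Rightarrow> complex"
  assumes "uniformly_continuous_on S f" "bounded (f ` S)"
  shows "uniformly_continuous_on S (\<lambda>x. f x ^ k)"
proof -
  obtain K where "\<And>x. x \<in> S \<Longrightarrow> cmod (f x) \<le> K" using assms(2) unfolding bounded_iff by blast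
  then have "f ` S \<subseteq> cball 0 K" by auto
  moreover have "uniformly_continuous_on (cball 0 K) (\<lambda>z::complex. z ^ k)"
    by (intro compact_uniformly_continuous continuous_intros compact_cball)
  ultimately have "uniformly_continuous_on (f ` S) (\<lambda>z. z ^ k)"
    unfolding uniformly_continuous_on_def by (meson subsetD)
  from uniformly_continuous_on_compose[OF assms(1) this] show ?thesis .
qed

lemma ball_algebra_Au: "ball_algebra Au_ball"
proof
  interpret H: ball_algebra Hinf_ball by (rule ball_algebra_Hinf)
  fix f g :: "'e::complex_banach \<Rightarrow> complex" and c k
  show "(0 :: 'e \<Rightarrow> complex) \<in> Au_ball"
    using H.zero_closed by (simp add: Au_ball_def zero_fun_def uniformly_continuous_on_const)
  assume "f \<in> Au_ball"
  then have f: "f \<in> Hinf_ball" "uniformly_continuous_on (ball 0 1) f" by (auto simp: Au_ball_def)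
  show "bounded (f ` ball 0 1)" using f(1) by (rule H.bounded)
  show "c *\<^sub>C f \<in> Au_ball"
    using f(2) H.scaleC_closed[OF f(1), of c]
    by (auto simp: Au_ball_def scaleC_fun_def scaleC_complex_def
        intro: bounded_linear.uniformly_continuous_on[OF bounded_linear_mult_right])
  show "(\<lambda>x. f x ^ Suc k) \<in> Au_ball"
    using uniformly_continuous_on_power_bounded[OF f(2) H.bounded[OF f(1)]]
      H.power_closed[OF f(1)] unfolding Au_ball_def by blast
  assume "g \<in> Au_ball"
  then have g: "g \<in> Hinf_ball" "uniformly_continuous_on (ball 0 1) g" by (auto simp: Au_ball_def)
  show "f + g \<in> Au_ball"
    using H.add_closed[OF f(1) g(1)] uniformly_continuous_on_add[OF f(2) g(2)]
    by (simp add: Au_ball_def plus_fun_def)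
qed

text \<open>Supplies a nonconstant element of each of the three algebras.  Without one, the algebra would
  be one-dimensional and its dual would have strongly exposed points.\<close>
lemma restricted_functional_in_Hinf:
  fixes L :: "'e::complex_banach \<Rightarrow> complex"
  assumes L: "bounded_linear L" "\<And>c x. L (c *\<^sub>C x) = c * L x" "\<And>x. cmod (L x) \<le> norm x"
  defines "l \<equiv> \<lambda>x. if x \<in> ball 0 1 then L x else 0"
  shows "l \<in> Hinf_ball" "l \<in> Ainf_ball" "l \<in> Au_ball"
proof -
  have "(l has_derivative L) (at x within ball 0 1)" if "x \<in> ball 0 1" for x
    using bounded_linear_imp_has_derivative[OF L(1)]
    by (rule has_derivative_transform[OF that, rotated]) (simp add: l_def)
  then have "holomorphic_banach l (ball 0 1)"
    unfolding holomorphic_banach_def using L(2) by blast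
  moreover have "cmod (l x) \<le> 1" for x
    using L(3)[of x] by (simp add: l_def)
  then have "bounded (l ` ball 0 1)" by (auto simp: bounded_iff)
  ultimately show H: "l \<in> Hinf_ball" by (simp add: Hinf_ball_def l_def)
  show "l \<in> Ainf_ball"
    using H linear_continuous_on[OF L(1)] unfolding Ainf_ball_def by (auto simp: l_def)
  have "uniformly_continuous_on (ball 0 1) L"
    using bounded_linear.uniformly_continuous_on[OF L(1) uniformly_continuous_on_id] .
  then have "uniformly_continuous_on (ball 0 1) l"
    by (simp add: uniformly_continuous_on_def l_def)
  then show "l \<in> Au_ball" using H by (simp add: Au_ball_def)
qed

section \<open>Point evaluations near an exposed point\<close>

context ball_algebra
begin

abbreviation dual :: "(('e \<Rightarrow> complex) \<Rightarrow> complex) set" where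
  "dual \<equiv> dual_space A sup_norm_ball"

abbreviation dnorm :: "(('e \<Rightarrow> complex) \<Rightarrow> complex) \<Rightarrow> real" where
  "dnorm \<equiv> dual_norm A sup_norm_ball"

text \<open>Functionals vanish outside \<open>A\<close> by convention, which the case distinction respects.\<close>
definition scaled_eval :: "complex \<Rightarrow> 'e \<Rightarrow> ('e \<Rightarrow> complex) \<Rightarrow> complex" where
  "scaled_eval c x g = (if g \<in> A then c * g x else 0)"

lemma scaleC_apply: "(c *\<^sub>C g) x = c * g x" for g :: "'e \<Rightarrow> complex"
  by (simp add: scaleC_fun_def scaleC_complex_def)

lemma cmod_le_sup_norm:
  assumes "g \<in> A" "x \<in> ball 0 1"
  shows "cmod (g x) \<le> sup_norm_ball g"
  unfolding sup_norm_ball_def using bdd_above_cmod_ball[OF bounded[OF assms(1)]] assms(2)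
  by (intro cSUP_upper)

lemma cmod_le_dual_norm:
  assumes "\<psi> \<in> dual" "g \<in> A" "\<And>x. x \<in> ball 0 1 \<Longrightarrow> cmod (g x) \<le> 1"
  shows "cmod (\<psi> g) \<le> dnorm \<psi>"
proof -
  obtain K where K: "\<And>v. v \<in> A \<Longrightarrow> cmod (\<psi> v) \<le> K * sup_norm_ball v"
    using assms(1) unfolding dual_space_def by blast
  have "cmod (\<psi> v) \<le> \<bar>K\<bar>" if "v \<in> A" "sup_norm_ball v \<le> 1" for v
  proof -
    have "0 \<le> sup_norm_ball v"
      using cmod_le_sup_norm[OF that(1), of 0] by (auto intro: order_trans[OF norm_ge_zero])
    then have "K * sup_norm_ball v \<le> \<bar>K\<bar> * 1" using that(2) by (intro mult_mono) auto
    then show ?thesis using K[OF that(1)] by simp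
  qed
  then have "bdd_above ((\<lambda>v. cmod (\<psi> v)) ` {v \<in> A. sup_norm_ball v \<le> 1})"
    by (intro bdd_aboveI2[where M = "\<bar>K\<bar>"]) auto
  then show ?thesis
    unfolding dual_norm_def using assms sup_norm_ball_le_one_iff[OF bounded[OF assms(2)]]
    by (intro cSUP_upper) auto
qed

lemma dual_diff_closed:
  assumes "\<psi> \<in> dual" "\<phi> \<in> dual"
  shows "\<psi> - \<phi> \<in> dual"
proof -
  obtain K where K: "\<And>v. v \<in> A \<Longrightarrow> cmod (\<psi> v) \<le> K * sup_norm_ball v"
    using assms(1) unfolding dual_space_def by blast
  obtain M where M: "\<And>v. v \<in> A \<Longrightarrow> cmod (\<phi> v) \<le> M * sup_norm_ball v"
    using assms(2) unfolding dual_space_def by blast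
  have "cmod (\<psi> v - \<phi> v) \<le> (K + M) * sup_norm_ball v" if "v \<in> A" for v
    using norm_triangle_ineq4[of "\<psi> v" "\<phi> v"] K[OF that] M[OF that]
    by (simp add: distrib_right)
  then have "\<exists>K. \<forall>v\<in>A. cmod (\<psi> v - \<phi> v) \<le> K * sup_norm_ball v" by blast
  then show ?thesis
    using assms by (auto simp: dual_space_def algebra_simps)
qed

lemma scaled_eval_in_dual:
  assumes "x \<in> ball 0 1"
  shows "scaled_eval c x \<in> dual" "dnorm (scaled_eval c x) \<le> cmod c"
proof -
  have bound: "cmod (scaled_eval c x g) \<le> cmod c * sup_norm_ball g" if "g \<in> A" for g
    using cmod_le_sup_norm[OF that assms] that
    by (simp add: scaled_eval_def norm_mult mult_left_mono)
  then have "\<exists>K. \<forall>g\<in>A. cmod (scaled_eval c x g) \<le> K * sup_norm_ball g" by blast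
  then show "scaled_eval c x \<in> dual"
    unfolding dual_space_def
    by (simp add: scaled_eval_def add_closed scaleC_closed scaleC_apply algebra_simps)
  have "0 \<in> {v \<in> A. sup_norm_ball v \<le> 1}"
    using zero_closed sup_norm_ball_le_one_iff[OF bounded[OF zero_closed]] by simp
  then show "dnorm (scaled_eval c x) \<le> cmod c"
    unfolding dual_norm_def
  proof (intro cSUP_least)
    fix g assume "g \<in> {v \<in> A. sup_norm_ball v \<le> 1}"
    then show "cmod (scaled_eval c x g) \<le> cmod c"
      using bound[of g] mult_left_mono[of "sup_norm_ball g" 1 "cmod c"] by auto
  qed blast
qed

text \<open>The norm of \<open>f\<close> as a functional on the dual is \<open>1\<close>, and evaluation at \<open>x\<close> is in the unit ball
  of the dual.\<close>
lemma exposing_function_le_one: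
  assumes "strongly_exposes dual dnorm (canonical_embedding A sup_norm_ball f) \<phi>"
    and "f \<in> A" "x \<in> ball 0 1"
  shows "cmod (f x) \<le> 1"
proof -
  let ?F = "canonical_embedding A sup_norm_ball f"
  have F: "?F \<in> dual_space dual dnorm" "dual_norm dual dnorm ?F = 1"
    using assms(1) by (auto simp: strongly_exposes_def)
  obtain K where K: "\<And>\<psi>. \<psi> \<in> dual \<Longrightarrow> cmod (?F \<psi>) \<le> K * dnorm \<psi>"
    using F(1) unfolding dual_space_def[of dual] by blast
  have "cmod (?F \<psi>) \<le> \<bar>K\<bar>" if "\<psi> \<in> dual" "dnorm \<psi> \<le> 1" for \<psi>
  proof -
    have "0 \<le> dnorm \<psi>"
      using cmod_le_dual_norm[OF that(1) zero_closed] by (auto intro: order_trans[OF norm_ge_zero])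
    then have "K * dnorm \<psi> \<le> \<bar>K\<bar> * 1" using that(2) by (intro mult_mono) auto
    then show ?thesis using K[OF that(1)] by simp
  qed
  then have "bdd_above ((\<lambda>\<psi>. cmod (?F \<psi>)) ` {\<psi> \<in> dual. dnorm \<psi> \<le> 1})"
    by (intro bdd_aboveI2[where M = "\<bar>K\<bar>"]) auto
  moreover have ev: "scaled_eval 1 x \<in> {\<psi> \<in> dual. dnorm \<psi> \<le> 1}"
    using scaled_eval_in_dual[OF assms(3), of 1] by simp
  ultimately have "cmod (?F (scaled_eval 1 x)) \<le> dual_norm dual dnorm ?F"
    unfolding dual_norm_def[of dual] by (intro cSUP_upper)
  then show ?thesis
    using ev F(2) assms(2) by (simp add: canonical_embedding_def scaled_eval_def)
qed

text \<open>If \<open>\<bar>f\<bar> \<le> r < 1\<close> on the ball, then \<open>f / r\<close> lies in the unit ball of \<open>A\<close>, yet \<open>\<phi>\<close> maps it to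
  \<open>1 / r\<close>, which exceeds the norm of \<open>\<phi>\<close>.\<close>
lemma exposing_function_nearly_one:
  assumes "strongly_exposes dual dnorm (canonical_embedding A sup_norm_ball f) \<phi>"
    and "f \<in> A" "0 < r" "r < 1"
  shows "\<exists>x\<in>ball 0 1. r < cmod (f x)"
proof (rule ccontr)
  assume "\<not> ?thesis"
  then have le: "\<And>x. x \<in> ball 0 1 \<Longrightarrow> cmod (f x) \<le> r" by force
  have \<phi>: "\<phi> \<in> dual" "dnorm \<phi> = 1" "\<phi> f = 1"
    using assms(1) by (auto simp: strongly_exposes_def canonical_embedding_def)
  let ?g = "complex_of_real (1 / r) *\<^sub>C f"
  have "cmod (?g x) \<le> 1" if "x \<in> ball 0 1" for x
    using le[OF that] \<open>0 < r\<close> by (simp add: scaleC_apply norm_mult norm_divide field_simps)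
  then have "cmod (\<phi> ?g) \<le> dnorm \<phi>"
    by (intro cmod_le_dual_norm \<phi>(1) scaleC_closed \<open>f \<in> A\<close>)
  moreover have "\<phi> ?g = complex_of_real (1 / r) * \<phi> f"
    using \<phi>(1) assms(2) unfolding dual_space_def by blast
  ultimately show False using \<open>0 < r\<close> \<open>r < 1\<close> \<phi>(2,3) by (simp add: norm_divide)
qed

text \<open>Point evaluations at points where \<open>\<bar>f\<bar>\<close> tends to its norm, multiplied by suitable scalars
  \<open>c n\<close>, form a sequence that the exposing property forces to converge to \<open>\<phi>\<close> in norm.  The
  conclusion expresses this norm convergence as convergence at a rate \<open>\<epsilon>\<close> uniform over the unit
  ball of \<open>A\<close>; the uniformity is what later contradicts the behaviour of the powers of \<open>f\<close>.\<close>
lemma evaluations_converge_to_exposed_point: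
  assumes exp: "strongly_exposes dual dnorm (canonical_embedding A sup_norm_ball f) \<phi>"
    and "f \<in> A" and x: "\<And>n. x n \<in> ball 0 1" and lim: "(\<lambda>n. cmod (f (x n))) \<longlonglongrightarrow> 1"
  obtains c \<epsilon> where "\<And>n::nat. cmod (c n) < 1" "(\<lambda>n. cmod (c n)) \<longlonglongrightarrow> 1" "\<epsilon> \<longlonglongrightarrow> 0"
    "\<And>n g. g \<in> A \<Longrightarrow> (\<And>y. y \<in> ball 0 1 \<Longrightarrow> cmod (g y) \<le> 1) \<Longrightarrow> cmod (c n * g (x n) - \<phi> g) \<le> \<epsilon> n"
proof -
  have "\<exists>u. cmod u = 1 \<and> u * z = of_real (cmod z)" for z :: complex
    using unimodular_rotation[of z] by blast
  then obtain u where u: "\<And>z. cmod (u z) = 1" "\<And>z. u z * z = of_real (cmod z)" by metis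
  \<comment> \<open>The factors \<open>r n < 1\<close> move the rotated evaluations into the open unit ball of the dual.\<close>
  define r :: "nat \<Rightarrow> real" where "r n = 1 - 1 / real (Suc n)" for n
  have r: "0 \<le> r n" "r n < 1" for n by (simp_all add: r_def field_simps)
  have r_lim: "r \<longlonglongrightarrow> 1"
    using tendsto_diff[OF tendsto_const LIMSEQ_inverse_real_of_nat, of 1]
    by (simp add: r_def[abs_def] inverse_eq_divide)
  define c where "c n = of_real (r n) * u (f (x n))" for n
  have norm_c: "cmod (c n) = r n" for n using r u by (simp add: c_def norm_mult)
  let ?\<psi> = "\<lambda>n. scaled_eval (c n) (x n)"
  have \<psi>: "?\<psi> n \<in> dual" "dnorm (?\<psi> n) < 1" for n
    using scaled_eval_in_dual[OF x, of "c n" n] r[of n] by (auto simp: norm_c)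
  have \<phi>: "\<phi> \<in> dual" using exp by (simp add: strongly_exposes_def)
  have "Re (canonical_embedding A sup_norm_ball f (?\<psi> n)) = r n * cmod (f (x n))" for n
  proof -
    have "c n * f (x n) = of_real (r n * cmod (f (x n)))"
      using u(2)[of "f (x n)"] by (simp add: c_def)
    then show ?thesis using \<psi>(1) \<open>f \<in> A\<close> by (simp add: canonical_embedding_def scaled_eval_def)
  qed
  then have "(\<lambda>n. Re (canonical_embedding A sup_norm_ball f (?\<psi> n))) \<longlonglongrightarrow> 1"
    using tendsto_mult[OF r_lim lim] by simp
  moreover have "\<forall>s. (\<forall>n. s n \<in> dual \<and> dnorm (s n) < 1) \<and>
      (\<lambda>n. Re (canonical_embedding A sup_norm_ball f (s n))) \<longlonglongrightarrow> 1 \<longrightarrow>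
      (\<lambda>n. dnorm (s n - \<phi>)) \<longlonglongrightarrow> 0"
    using exp unfolding strongly_exposes_def by blast
  ultimately have "(\<lambda>n. dnorm (?\<psi> n - \<phi>)) \<longlonglongrightarrow> 0"
    using \<psi> by (elim allE[of _ ?\<psi>]) simp
  moreover have "cmod (c n * g (x n) - \<phi> g) \<le> dnorm (?\<psi> n - \<phi>)"
    if "g \<in> A" "\<And>y. y \<in> ball 0 1 \<Longrightarrow> cmod (g y) \<le> 1" for n g
    using cmod_le_dual_norm[OF dual_diff_closed[OF \<psi>(1)[of n] \<phi>] that] that(1)
    by (simp add: scaled_eval_def)
  ultimately show thesis
    using that[of c "\<lambda>n. dnorm (?\<psi> n - \<phi>)"] r r_lim by (simp add: norm_c)
qed

text \<open>Passing to moduli removes the scalars \<open>c n\<close>, about whose arguments nothing is known.\<close>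
lemma exposed_point_modulus:
  assumes "strongly_exposes dual dnorm (canonical_embedding A sup_norm_ball f) \<phi>"
    and "f \<in> A" "\<And>n. x n \<in> ball 0 1" "(\<lambda>n. cmod (f (x n))) \<longlonglongrightarrow> 1"
    and g: "g \<in> A" "\<And>y. y \<in> ball 0 1 \<Longrightarrow> cmod (g y) \<le> 1"
  shows "(\<lambda>n. cmod (g (x n))) \<longlonglongrightarrow> cmod (\<phi> g)"
proof -
  obtain c \<epsilon> where c: "\<And>n::nat. cmod (c n) < 1" "(\<lambda>n. cmod (c n)) \<longlonglongrightarrow> 1"
    and \<epsilon>: "\<epsilon> \<longlonglongrightarrow> 0" "\<And>n. cmod (c n * g (x n) - \<phi> g) \<le> \<epsilon> n"
    using evaluations_converge_to_exposed_point[OF assms(1-4)] g by metis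
  have "(\<lambda>n. c n * g (x n)) \<longlonglongrightarrow> \<phi> g"
    using Lim_null_comparison[OF always_eventually \<epsilon>(1), of "\<lambda>n. c n * g (x n) - \<phi> g"] \<epsilon>(2)
    by (simp add: LIM_zero_iff)
  then have "(\<lambda>n. cmod (c n * g (x n))) \<longlonglongrightarrow> cmod (\<phi> g)" by (rule tendsto_norm)
  moreover have "(\<lambda>n. cmod (c n * g (x n)) - cmod (g (x n))) \<longlonglongrightarrow> 0"
  proof (rule Lim_null_comparison)
    show "\<forall>\<^sub>F n in sequentially.
        norm (cmod (c n * g (x n)) - cmod (g (x n))) \<le> 1 - cmod (c n)"
    proof (intro always_eventually allI)
      fix n
      have "cmod (g (x n)) - cmod (c n * g (x n)) = (1 - cmod (c n)) * cmod (g (x n))"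
        by (simp add: norm_mult algebra_simps)
      moreover have "\<dots> \<le> (1 - cmod (c n)) * 1"
        using c(1)[of n] g(2)[OF assms(3)] by (intro mult_left_mono) auto
      moreover have "0 \<le> (1 - cmod (c n)) * cmod (g (x n))" using c(1)[of n] by simp
      ultimately show "norm (cmod (c n * g (x n)) - cmod (g (x n))) \<le> 1 - cmod (c n)" by simp
    qed
    show "(\<lambda>n. 1 - cmod (c n)) \<longlonglongrightarrow> 0"
      using tendsto_diff[OF tendsto_const c(2), of 1] by simp
  qed
  ultimately show ?thesis using tendsto_diff by fastforce
qed

text \<open>Suppose \<open>\<bar>f\<bar> < 1\<close> on the ball and let \<open>x n\<close> be points with \<open>\<bar>f (x n)\<bar>\<close> tending to \<open>1\<close>.  For each
  fixed exponent, \<open>\<bar>\<phi> (f ^ k)\<bar>\<close> is the limit of \<open>\<bar>f (x n) ^ k\<bar>\<close> in \<open>n\<close>, that is, \<open>1\<close>.  For each fixed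
  \<open>n\<close>, however, \<open>f (x n) ^ k\<close> tends to \<open>0\<close> in \<open>k\<close>, so no multiple of the evaluation at \<open>x n\<close> by a
  scalar of modulus at most \<open>1\<close> is within distance \<open>1 / 2\<close> of \<open>\<phi>\<close>.\<close>
lemma exposing_function_attains_norm:
  assumes exp: "strongly_exposes dual dnorm (canonical_embedding A sup_norm_ball f) \<phi>"
    and "f \<in> A"
  shows "\<exists>x\<in>ball 0 1. cmod (f x) = 1"
proof (rule ccontr)
  assume "\<not> ?thesis"
  then have less: "cmod (f x) < 1" if "x \<in> ball 0 1" for x
    using exposing_function_le_one[OF exp \<open>f \<in> A\<close> that] that by force
  have "\<exists>y\<in>ball 0 1. 1 - 1 / real (n + 2) < cmod (f y)" for n
    by (intro exposing_function_nearly_one[OF exp \<open>f \<in> A\<close>]) (simp_all add: field_simps)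
  then obtain x where x: "\<And>n. x n \<in> ball 0 1" "\<And>n. 1 - 1 / real (n + 2) < cmod (f (x n))" by metis
  have lim: "(\<lambda>n. cmod (f (x n))) \<longlonglongrightarrow> 1"
  proof (rule tendsto_sandwich)
    show "\<forall>\<^sub>F n in sequentially. 1 - 1 / real (n + 2) \<le> cmod (f (x n))"
      using x(2) by (intro always_eventually) (auto intro: less_imp_le)
    show "\<forall>\<^sub>F n in sequentially. cmod (f (x n)) \<le> 1"
      using less[OF x(1)] by (intro always_eventually) (auto intro: less_imp_le)
    show "(\<lambda>n. 1 - 1 / real (n + 2)) \<longlonglongrightarrow> 1"
      using LIMSEQ_ignore_initial_segment[OF tendsto_diff[OF tendsto_const
          LIMSEQ_inverse_real_of_nat, of 1], of 1] by (simp add: inverse_eq_divide)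
  qed simp
  have pow: "(\<lambda>y. f y ^ Suc k) \<in> A" "y \<in> ball 0 1 \<Longrightarrow> cmod (f y ^ Suc k) \<le> 1" for k y
    using power_closed[OF \<open>f \<in> A\<close>] less[of y]
    by (simp_all add: norm_power power_le_one del: power_Suc)
  have modulus_one: "cmod (\<phi> (\<lambda>y. f y ^ Suc k)) = 1" for k
  proof (rule LIMSEQ_unique)
    show "(\<lambda>n. cmod (f (x n) ^ Suc k)) \<longlonglongrightarrow> cmod (\<phi> (\<lambda>y. f y ^ Suc k))"
      by (rule exposed_point_modulus[OF exp \<open>f \<in> A\<close> x(1) lim pow])
    show "(\<lambda>n. cmod (f (x n) ^ Suc k)) \<longlonglongrightarrow> 1"
      using tendsto_power[OF lim, of "Suc k"] by (simp add: norm_power del: power_Suc)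
  qed
  obtain c \<epsilon> where c: "\<And>n::nat. cmod (c n) < 1" and \<epsilon>: "\<epsilon> \<longlonglongrightarrow> 0"
    and close: "\<And>n g. g \<in> A \<Longrightarrow> (\<And>y. y \<in> ball 0 1 \<Longrightarrow> cmod (g y) \<le> 1) \<Longrightarrow>
      cmod (c n * g (x n) - \<phi> g) \<le> \<epsilon> n"
    using evaluations_converge_to_exposed_point[OF exp \<open>f \<in> A\<close> x(1) lim] by metis
  obtain n where n: "\<epsilon> n < 1 / 2"
    using order_tendstoD(2)[OF \<epsilon>, of "1 / 2"] by (auto simp: eventually_sequentially)
  obtain k where k: "cmod (f (x n)) ^ Suc k < 1 / 2"
  proof -
    obtain k where "cmod (f (x n)) ^ k < 1 / 2"
      using real_arch_pow_inv[of "1 / 2" "cmod (f (x n))"] less[OF x(1)] by auto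
    moreover have "cmod (f (x n)) ^ Suc k \<le> cmod (f (x n)) ^ k"
      using less[OF x(1), of n] by (intro power_decreasing) auto
    ultimately have "cmod (f (x n)) ^ Suc k < 1 / 2" by (metis order_le_less_trans)
    then show thesis by (rule that)
  qed
  have "cmod (c n * f (x n) ^ Suc k) \<le> 1 * cmod (f (x n)) ^ Suc k"
    unfolding norm_mult norm_power using c[of n] by (intro mult_right_mono) auto
  moreover have "1 \<le> cmod (c n * f (x n) ^ Suc k) + cmod (c n * f (x n) ^ Suc k - \<phi> (\<lambda>y. f y ^ Suc k))"
    using norm_triangle_sub[of "\<phi> (\<lambda>y. f y ^ Suc k)" "c n * f (x n) ^ Suc k"] modulus_one[of k]
    by (simp add: norm_minus_commute)
  moreover have "cmod (c n * f (x n) ^ Suc k - \<phi> (\<lambda>y. f y ^ Suc k)) \<le> \<epsilon> n"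
    by (rule close[OF pow])
  ultimately show False using k n by linarith
qed

text \<open>Since \<open>f\<close> attains its norm, it is constant of modulus \<open>1\<close>, so every constant sequence of points
  is admissible for \<open>exposed_point_modulus\<close>.  Every function in the unit ball of \<open>A\<close> would then have
  constant modulus.\<close>
lemma no_weak_star_strongly_exposed_point:
  assumes "A \<subseteq> Hinf_ball"
    and l: "l \<in> A" "\<And>x. x \<in> ball 0 1 \<Longrightarrow> cmod (l x) \<le> 1"
    and y: "y \<in> ball 0 1" "z \<in> ball 0 1" "cmod (l y) \<noteq> cmod (l z)"
  shows "\<not> weak_star_strongly_exposed_point A sup_norm_ball \<phi>"
proof
  assume "weak_star_strongly_exposed_point A sup_norm_ball \<phi>"
  then obtain f where "f \<in> A" and
    exp: "strongly_exposes dual dnorm (canonical_embedding A sup_norm_ball f) \<phi>"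
    by (auto simp: weak_star_strongly_exposed_point_def)
  obtain x where x: "x \<in> ball 0 1" "cmod (f x) = 1"
    using exposing_function_attains_norm[OF exp \<open>f \<in> A\<close>] by blast
  have "f w = f x" if "w \<in> ball 0 1" for w
    using \<open>f \<in> A\<close> \<open>A \<subseteq> Hinf_ball\<close> exposing_function_le_one[OF exp \<open>f \<in> A\<close>] x that
    by (intro maximum_modulus_convex[where U = "ball 0 1"]) (auto simp: Hinf_ball_def)
  then have "cmod (l w) = cmod (\<phi> l)" if "w \<in> ball 0 1" for w
    using exposed_point_modulus[OF exp \<open>f \<in> A\<close> _ _ l, of "\<lambda>_. w"] that x(2)
    by (simp add: LIMSEQ_const_iff)
  then show False using y by metis
qed

end

theorem theorem2p1:
  fixes A :: "('e::complex_banach \<Rightarrow> complex) set"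
  assumes "\<exists>x::'e. x \<noteq> 0"
    and "A = Au_ball \<or> A = Ainf_ball \<or> A = Hinf_ball"
  shows "\<not> (\<exists>\<phi>. weak_star_strongly_exposed_point A sup_norm_ball \<phi>)"
proof -
  obtain x0 :: 'e where "x0 \<noteq> 0" using assms(1) by blast
  \<comment> \<open>The points \<open>0\<close> and \<open>v\<close> of the ball are told apart by the modulus of a norming functional for \<open>v\<close>.\<close>
  define v where "v = (1 / (2 * norm x0)) *\<^sub>R x0"
  have v: "norm v = 1 / 2" using \<open>x0 \<noteq> 0\<close> by (simp add: v_def)
  obtain L :: "'e \<Rightarrow> complex" where L: "bounded_linear L" "\<And>c x. L (c *\<^sub>C x) = c * L x"
    "\<And>x. cmod (L x) \<le> norm x" "Re (L v) = norm v"
    using complex_norming_functional[of v] by blast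
  define l where "l x = (if x \<in> ball 0 1 then L x else 0)" for x
  have "l \<in> A"
    using assms(2) restricted_functional_in_Hinf[OF L(1-3)] unfolding l_def[abs_def] by blast
  have "ball_algebra A"
    using assms(2) ball_algebra_Hinf ball_algebra_Ainf ball_algebra_Au by blast
  then interpret ball_algebra A .
  have "A \<subseteq> Hinf_ball" using assms(2) by (auto simp: Au_ball_def Ainf_ball_def)
  moreover have "cmod (l x) \<le> 1" for x
    using L(3)[of x] by (simp add: l_def)
  moreover have "l 0 = 0" "l v \<noteq> 0"
    using L(4) v linear_0[OF bounded_linear.linear[OF L(1)]] by (auto simp: l_def)
  ultimately have "\<not> weak_star_strongly_exposed_point A sup_norm_ball \<phi>" for \<phi>
    using \<open>l \<in> A\<close> v by (intro no_weak_star_strongly_exposed_point[of l 0 v]) auto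
  then show ?thesis by blast
qed

end
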